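(* Let $m\in\mathbb{N}$ be odd, $x,y>0$ real, $p\in\mathbb{R}$, $n\in\mathbb{N}_0$ and $\lambda\in\mathbb{C}$. Then $$G_{n}(mx,py;\lambda)=m^{n-1}\sum_{k=0}^{m-1}\lambda^{k}(-1)^{k}\,{}_{H}G_{n}\Big(x+\frac{k}{m},\frac{py}{m^{2}};\lambda^{m}\Big).$$
   Context: The Apostol-Genocchi polynomials are defined by $\frac{2te^{xt}}{\lambda e^{t}+1}=\sum_{n\ge0}G_{n}(x;\lambda)\frac{t^{n}}{n!}$. The 2-variable Apostol-Genocchi polynomials are defined by $\frac{2t\,e^{xt+yt^{2}}}{\lambda e^{t}+1}=\sum_{n\ge0}G_{n}(x,y;\lambda)\frac{t^{n}}{n!}$. Further, ${}_{H}G_{n}(x,y;\lambda)=n!\sum_{s=0}^{\lfloor n/2\rfloor}\frac{y^{s}G_{n-2s}(x;\lambda)}{s!(n-2s)!}$. *)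

theory Defs
  imports "HOL-Computational_Algebra.Formal_Power_Series"
begin

text \<open>
  The generating functions are read as formal power series in \<open>t\<close> over the complex numbers.
  For \<open>lam = -1\<close> the denominator has zero constant term; the quotient is then still exact,
  because the numerator carries the factor \<open>t\<close> (see the lemmas below).
\<close>

definition apostol_genocchi :: "nat \<Rightarrow> complex \<Rightarrow> complex \<Rightarrow> complex" where
  "apostol_genocchi n x lam =
     fact n * fps_nth (2 * fps_X * fps_exp x / (fps_const lam * fps_exp 1 + 1)) n"

definition apostol_genocchi2 :: "nat \<Rightarrow> complex \<Rightarrow> complex \<Rightarrow> complex \<Rightarrow> complex" where
  "apostol_genocchi2 n x y lam =
     fact n * fps_nth
       (2 * fps_X * (fps_exp 1 oo (fps_const x * fps_X + fps_const y * fps_X ^ 2))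
          / (fps_const lam * fps_exp 1 + 1)) n"

definition hermite_apostol_genocchi :: "nat \<Rightarrow> complex \<Rightarrow> complex \<Rightarrow> complex \<Rightarrow> complex" where
  "hermite_apostol_genocchi n x y lam =
     fact n * (\<Sum>s = 0..n div 2.
       y ^ s * apostol_genocchi (n - 2 * s) x lam / (fact s * fact (n - 2 * s)))"

lemma apostol_genocchi_denom_dvd:
  "(fps_const lam * fps_exp 1 + 1 :: complex fps) dvd 2 * fps_X * f"
proof -
  let ?D = "fps_const lam * fps_exp 1 + 1 :: complex fps"
  have "fps_nth ?D 0 \<noteq> 0 \<or> fps_nth ?D 1 \<noteq> 0"
    by auto
  then have D: "?D \<noteq> 0" and le: "subdegree ?D \<le> 1"
    using subdegree_leI[of ?D 0] subdegree_leI[of ?D 1] by (metis fps_zero_nth, linarith)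
  show ?thesis
  proof (cases "f = 0")
    case False
    then have nz: "2 * fps_X * f \<noteq> 0" by simp
    have "fps_nth (2 * fps_X * f) 0 = 0" by simp
    then have "subdegree (2 * fps_X * f) \<ge> 1"
      using nz by (metis One_nat_def Suc_leI gr0I nth_subdegree_nonzero)
    then show ?thesis using D nz le by (simp add: fps_dvd_iff)
  qed simp
qed

lemma apostol_genocchi_gf:
  "(fps_const lam * fps_exp 1 + 1) * Abs_fps (\<lambda>n. apostol_genocchi n x lam / fact n)
     = 2 * fps_X * fps_exp x"
  using dvd_mult_div_cancel[OF apostol_genocchi_denom_dvd[of lam "fps_exp x"]]
  by (simp add: apostol_genocchi_def fps_nth_inverse)

lemma apostol_genocchi2_gf:
  "(fps_const lam * fps_exp 1 + 1) * Abs_fps (\<lambda>n. apostol_genocchi2 n x y lam / fact n)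
     = 2 * fps_X * (fps_exp 1 oo (fps_const x * fps_X + fps_const y * fps_X ^ 2))"
  using dvd_mult_div_cancel[OF apostol_genocchi_denom_dvd
      [of lam "fps_exp 1 oo (fps_const x * fps_X + fps_const y * fps_X ^ 2)"]]
  by (simp add: apostol_genocchi2_def fps_nth_inverse)

end

theory Submission
  imports Defs
begin

text \<open>
  Put \<open>D(\<lambda>) = \<lambda> e\<^sup>t + 1\<close>. The Hermite-type polynomials have generating function
  \<open>2t e\<^bsup>xt + yt\<^sup>2\<^esup> / D(\<lambda>)\<close>, because the exponential splits as \<open>e\<^bsup>xt\<^esup> e\<^bsup>yt\<^sup>2\<^esup>\<close>; hence they
  coincide with the 2-variable polynomials. Replacing \<open>t\<close> by \<open>mt\<close> and \<open>\<lambda>\<close> by \<open>\<lambda>\<^sup>m\<close>, the alternating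
  sum over \<open>k\<close> becomes a geometric sum in \<open>-\<lambda> e\<^sup>t\<close>, equal to \<open>(1 + \<lambda>\<^sup>m e\<^bsup>mt\<^esup>) / (1 + \<lambda> e\<^sup>t)\<close> since
  \<open>m\<close> is odd. Denominators are cleared throughout, as \<open>D(-1)\<close> is not invertible, merely nonzero.
\<close>

text \<open>The quotient \<open>f * inverse h\<close> has derivative zero, so it is constant, and
  the equal initial values make that constant 1.\<close>

lemma fps_linear_ode_unique:
  fixes f h :: "'a::field_char_0 fps"
  assumes "fps_deriv f = g * f" "fps_deriv h = g * h" "fps_nth f 0 = fps_nth h 0"
    and h0: "fps_nth h 0 \<noteq> 0"
  shows "f = h"
proof -
  have inv: "h * inverse h = 1"
    using h0 by (simp add: inverse_mult_eq_1')
  have "fps_deriv (f * inverse h) = g * f * inverse h * (1 - h * inverse h)"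
    using h0 by (simp add: fps_inverse_deriv assms(1,2) power2_eq_square algebra_simps)
  then have "fps_deriv (f * inverse h) = 0"
    by (simp add: inv)
  then have "f * inverse h = fps_const (fps_nth (f * inverse h) 0)"
    unfolding fps_deriv_eq_0_iff .
  also have "fps_nth (f * inverse h) 0 = 1"
    using assms(3) h0 by simp
  finally have "f * inverse h * h = h" by simp
  then show ?thesis
    using inv by (simp add: mult.assoc mult.commute[of "inverse h"])
qed

text \<open>Both sides solve u' = c (a' + b') u with initial value 1.\<close>

lemma fps_exp_compose_add:
  fixes a b :: "'a::field_char_0 fps"
  assumes "fps_nth a 0 = 0" "fps_nth b 0 = 0"
  shows "fps_exp c oo (a + b) = (fps_exp c oo a) * (fps_exp c oo b)"
proof (rule fps_linear_ode_unique[where g = "fps_const c * (fps_deriv a + fps_deriv b)"])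
  show "fps_deriv (fps_exp c oo (a + b)) =
      fps_const c * (fps_deriv a + fps_deriv b) * (fps_exp c oo (a + b))"
    using assms by (simp add: fps_compose_deriv fps_compose_mult_distrib algebra_simps)
  show "fps_deriv ((fps_exp c oo a) * (fps_exp c oo b)) =
      fps_const c * (fps_deriv a + fps_deriv b) * ((fps_exp c oo a) * (fps_exp c oo b))"
    using assms by (simp add: fps_compose_deriv fps_compose_mult_distrib algebra_simps)
qed simp_all

lemma fps_exp_compose_const_mult:
  fixes a :: "'a::field_char_0 fps"
  assumes "fps_nth a 0 = 0"
  shows "fps_exp d oo (fps_const c * a) = fps_exp (c * d) oo a"
proof -
  have "fps_exp d oo ((fps_const c * fps_X) oo a) = (fps_exp d oo (fps_const c * fps_X)) oo a"
    using assms by (intro fps_compose_assoc) simp_all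
  then show ?thesis
    using assms by (simp add: fps_compose_mult_distrib)
qed

text \<open>Only even powers of t occur in f(t^2), so the Cauchy product reduces to the indices i =
  2s. For \<open>f = fps_exp y\<close> this produces the sum that defines
  \<open>hermite_apostol_genocchi\<close>.\<close>

lemma fps_nth_mult_compose_X_square:
  fixes f g :: "'a::idom fps"
  shows "fps_nth ((f oo fps_X ^ 2) * g) n =
    (\<Sum>s = 0..n div 2. fps_nth f s * fps_nth g (n - 2 * s))"
proof -
  have coeff: "fps_nth (f oo fps_X ^ 2) i = (if even i then fps_nth f (i div 2) else 0)" for i
  proof -
    have "fps_nth (f oo fps_X ^ 2) i = (\<Sum>j = 0..i. if i = 2 * j then fps_nth f j else 0)"
      by (simp add: fps_compose_nth fps_X_power_nth flip: power_mult) (intro sum.cong, auto)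
    also have "\<dots> = (\<Sum>j\<in>{0..i}. if j = i div 2 \<and> even i then fps_nth f j else 0)"
      by (intro sum.cong) auto
    also have "\<dots> = (if even i then fps_nth f (i div 2) else 0)"
      by (simp add: if_distrib cong: if_cong)
    finally show ?thesis .
  qed
  have "fps_nth ((f oo fps_X ^ 2) * g) n =
      (\<Sum>i\<in>{0..n}. (if even i then fps_nth f (i div 2) else 0) * fps_nth g (n - i))"
    by (simp only: fps_mult_nth coeff)
  also have "\<dots> = (\<Sum>i\<in>(\<lambda>s. 2 * s) ` {0..n div 2}.
      (if even i then fps_nth f (i div 2) else 0) * fps_nth g (n - i))"
    by (rule sum.mono_neutral_right) (auto elim!: evenE)
  also have "\<dots> = (\<Sum>s = 0..n div 2. fps_nth f s * fps_nth g (n - 2 * s))"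
    by (subst sum.reindex) (auto simp: inj_on_def)
  finally show ?thesis .
qed

text \<open>The first two coefficients are lam + 1 and lam, which cannot both vanish.\<close>

lemma apostol_denom_nonzero: "(fps_const lam * fps_exp 1 + 1 :: complex fps) \<noteq> 0"
proof
  assume "(fps_const lam * fps_exp 1 + 1 :: complex fps) = 0"
  then have "fps_nth (fps_const lam * fps_exp 1 + 1) i = 0" for i
    by simp
  from this[of 0] this[of 1] show False by auto
qed

lemma hermite_apostol_genocchi_eq:
  "hermite_apostol_genocchi n x y lam = apostol_genocchi2 n x y lam"
proof -
  define D where "D = (fps_const lam * fps_exp 1 + 1 :: complex fps)"
  define A where "A = Abs_fps (\<lambda>n. apostol_genocchi n x lam / fact n)"
  define B where "B = Abs_fps (\<lambda>n. apostol_genocchi2 n x y lam / fact n)"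
  have exp_split: "fps_exp 1 oo (fps_const x * fps_X + fps_const y * fps_X ^ 2) =
      (fps_exp y oo fps_X ^ 2) * fps_exp x"
    by (simp add: fps_exp_compose_add fps_exp_compose_const_mult)
  have "D * ((fps_exp y oo fps_X ^ 2) * A) = (fps_exp y oo fps_X ^ 2) * (D * A)"
    by (simp only: mult_ac)
  also have "\<dots> = D * B"
    unfolding D_def A_def B_def apostol_genocchi_gf apostol_genocchi2_gf exp_split
    by (simp only: mult_ac)
  finally have "(fps_exp y oo fps_X ^ 2) * A = B"
    using apostol_denom_nonzero[of lam] by (simp add: D_def)
  then have "fps_nth ((fps_exp y oo fps_X ^ 2) * A) n = fps_nth B n"
    by simp
  then show ?thesis
    unfolding fps_nth_mult_compose_X_square
    by (simp add: A_def B_def hermite_apostol_genocchi_def field_simps)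
qed

text \<open>Multiplying through by m avoids the exponent n - 1, which is negative for n = 0.\<close>

lemma apostol_genocchi2_multiplication:
  assumes "odd m"
  shows "of_nat m * apostol_genocchi2 n (of_nat m * x) y lam =
    of_nat m ^ n * (\<Sum>k<m. (- lam) ^ k *
      apostol_genocchi2 n (x + of_nat k / of_nat m) (y / (of_nat m)\<^sup>2) (lam ^ m))"
proof -
  from assms have m: "m \<noteq> 0" by (auto intro: ccontr)
  define c :: complex where "c = of_nat m"
  have c: "c \<noteq> 0" using m by (simp add: c_def)
  define E where "E = (fps_exp 1 :: complex fps)"
  define D where "D = fps_const lam * E + 1"
  define Dm where "Dm = fps_const (lam ^ m) * E + 1"
  \<comment> \<open>Composing with \<open>T\<close> is the substitution of mt for t; it scales the
    n-th coefficient by m^n.\<close>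
  define T where "T = fps_const c * fps_X"
  define F where "F = Abs_fps (\<lambda>n. apostol_genocchi2 n (c * x) y lam / fact n)"
  define B where "B = (\<lambda>k. Abs_fps (\<lambda>n.
    apostol_genocchi2 n (x + of_nat k / c) (y / c\<^sup>2) (lam ^ m) / fact n))"
  define P where "P = (fps_exp 1 oo (fps_const (c * x) * fps_X + fps_const y * fps_X ^ 2))"
  have T0: "fps_nth T 0 = 0" by (simp add: T_def)
  have T2: "fps_X ^ 2 oo T = fps_const (c\<^sup>2) * fps_X ^ 2"
    by (simp add: fps_compose_power[OF T0, symmetric] T0)
      (simp add: T_def power_mult_distrib fps_const_power)
  have F: "D * F = 2 * fps_X * P"
    unfolding D_def E_def F_def P_def by (rule apostol_genocchi2_gf)
  have BT: "(Dm oo T) * (B k oo T) = 2 * T * (E ^ k * P)" for k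
  proof -
    let ?q = "fps_const (x + of_nat k / c) * fps_X + fps_const (y / c\<^sup>2) * fps_X ^ 2"
    \<comment> \<open>The shift k/m and the divisor m^2 are chosen for this: after the substitution,
      k enters only through the summand kt, which becomes the factor \<open>E ^ k\<close>.\<close>
    have "?q oo T = fps_const (of_nat k) * fps_X +
        (fps_const (c * x) * fps_X + fps_const y * fps_X ^ 2)"
      using c by (simp add: T0 T2 fps_compose_add_distrib fps_compose_mult_distrib)
        (simp add: fps_eq_iff T_def field_simps)
    moreover have "(fps_exp 1 oo ?q) oo T = fps_exp 1 oo (?q oo T)"
      by (rule fps_compose_assoc[symmetric]) (simp_all add: T0)
    ultimately have "(fps_exp 1 oo ?q) oo T = E ^ k * P"
      by (simp only: fps_exp_compose_add[of "fps_const (of_nat k) * fps_X"] P_def E_def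
          fps_exp_power_mult) (simp add: fps_exp_compose_add fps_exp_power_mult)
    moreover have "Dm * B k = 2 * fps_X * (fps_exp 1 oo ?q)"
      unfolding Dm_def E_def B_def by (rule apostol_genocchi2_gf)
    then have "(Dm * B k) oo T = (2 * fps_X * (fps_exp 1 oo ?q)) oo T"
      by simp
    ultimately show ?thesis
      by (simp add: T0 fps_compose_mult_distrib)
  qed
  have "(1 - (- (fps_const lam * E)) ^ m) = D * (\<Sum>k<m. (- (fps_const lam * E)) ^ k)"
    unfolding one_diff_power_eq by (simp add: D_def algebra_simps)
  \<comment> \<open>Oddness of m enters here, turning -(-1)^m into +1.\<close>
  moreover have "Dm oo T = 1 - (- (fps_const lam * E)) ^ m"
    using assms by (simp add: Dm_def fps_compose_add_distrib fps_compose_mult_distrib T0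
        E_def T_def power_mult_distrib fps_exp_power_mult c_def fps_const_power)
  moreover have "(- (fps_const lam * E)) ^ k = fps_const ((- lam) ^ k) * E ^ k" for k
    by (simp add: power_mult_distrib flip: fps_const_power fps_const_neg mult_minus_left)
  ultimately have geom: "D * (\<Sum>k<m. fps_const ((- lam) ^ k) * E ^ k) = Dm oo T"
    by simp
  \<comment> \<open>The extra factor \<open>D\<close> lets \<open>geom\<close> collapse the sum over
    k into \<open>Dm oo T\<close>; both factors are nonzero and cancel at the end.\<close>
  have "D * ((Dm oo T) * (\<Sum>k<m. fps_const ((- lam) ^ k) * (B k oo T))) =
      D * (\<Sum>k<m. fps_const ((- lam) ^ k) * ((Dm oo T) * (B k oo T)))"
    by (simp add: sum_distrib_left mult_ac)
  also have "\<dots> = D * (\<Sum>k<m. fps_const ((- lam) ^ k) * E ^ k) * (2 * T * P)"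
    by (simp add: BT sum_distrib_left sum_distrib_right mult_ac)
  \<comment> \<open>The numerator 2t has become 2mt, whence the factor \<open>c\<close> in front of
    \<open>F\<close>.\<close>
  also have "\<dots> = D * ((Dm oo T) * (fps_const c * F))"
    unfolding geom using F by (simp add: T_def mult_ac)
  finally have "(\<Sum>k<m. fps_const ((- lam) ^ k) * (B k oo T)) = fps_const c * F"
    using apostol_denom_nonzero[of lam] apostol_denom_nonzero[of "lam ^ m"] c
    by (simp add: D_def Dm_def E_def T_def fps_compose_eq_0_iff)
  then have "fps_nth (\<Sum>k<m. fps_const ((- lam) ^ k) * (B k oo T)) n = fps_nth (fps_const c * F) n"
    by simp
  then show ?thesis
    by (simp add: fps_sum_nth T_def B_def F_def c_def sum_distrib_left
        flip: sum_divide_distrib) (simp add: field_simps flip: sum_divide_distrib)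
qed

theorem theorem4p1:
  fixes m n :: nat and x y p :: real and lam :: complex
  assumes "odd m" and "x > 0" and "y > 0"
  shows "apostol_genocchi2 n (complex_of_real (real m * x)) (complex_of_real (p * y)) lam =
    complex_of_real (real m powi (int n - 1)) *
      (\<Sum>k = 0..m - 1. lam ^ k * (-1) ^ k *
        hermite_apostol_genocchi n
          (complex_of_real (x + real k / real m))
          (complex_of_real (p * y / (real m)\<^sup>2))
          (lam ^ m))"
proof -
  from assms have m: "m \<noteq> 0" by (auto intro: ccontr)
  \<comment> \<open>For m = 0 truncated subtraction would leave the index 0 on the left.\<close>
  then have "{0..m - 1} = {..<m}" by auto
  moreover have "lam ^ k * (-1) ^ k = (- lam) ^ k" for k
    by (simp flip: power_mult_distrib)
  ultimately show ?thesis
    using apostol_genocchi2_multiplication[OF assms(1), of n x "p * y" lam] m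
    by (simp add: hermite_apostol_genocchi_eq power_int_diff field_simps)
qed

end
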